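(* Let $(\mathcal{A};\mathcal{WKC})$ be a weak kernel-cokernel category, let $(\mathcal{I},\mathcal{J})$ be an ideal torsion pair in $\mathcal{A}$, and let $X\in\mathcal{A}$ be an object. The following are equivalent for a weak conflation $T\xrightarrow{\,i\,}X\xrightarrow{\,j\,}F$ (i.e. a member of $\mathcal{WKC}$): (1) $i\colon T\to X$ is an $\mathcal{I}$-precover of $X$; (2) $i\in\mathcal{I}$ and $j\in\mathcal{J}$; (3) $j\colon X\to F$ is a $\mathcal{J}$-preenvelope of $X$; (4) $i\colon T\to X$ is an $\mathcal{I}$-precover of $X$ and $j\colon X\to F$ is a $\mathcal{J}$-preenvelope of $X$.
   Context: Additive categories have finite coproducts. An ideal $\mathcal{I}$ of an additive category $\mathcal{A}$ is an additive subbifunctor of $\mathrm{Hom}(-,-)$, i.e. subgroups $\mathcal{I}(A,B)\subseteq\mathrm{Hom}(A,B)$ closed under composition on either side with arbitrary morphisms. Morphisms $i\colon X\to A$ and $j\colon B\to Y$ are Hom-orthogonal, $\mathrm{Hom}(i,j)=0$, if $jxi=0$ for all $x\colon A\to B$. For a collection $\mathcal{M}$ of morphisms, $\mathcal{M}^{\perp}=\{j\mid \mathrm{Hom}(f,j)=0\ \forall f\in\mathcal{M}\}$ and ${}^{\perp}\mathcal{M}=\{i\mid \mathrm{Hom}(i,f)=0\ \forall f\in\mathcal{M}\}$. A pair $(\mathcal{I},\mathcal{J})$ of ideals is an ideal torsion pair if $\mathcal{I}={}^{\perp}\mathcal{J}$ and $\mathcal{J}=\mathcal{I}^{\perp}$.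 A weak kernel of $g\colon Y\to Z$ is a morphism $k\colon X\to Y$ with $gk=0$ such that every $k'\colon X'\to Y$ with $gk'=0$ factors (not necessarily uniquely) through $k$; weak cokernels are dual. A weak kernel-cokernel pair is a composable pair $X\xrightarrow{k}Y\xrightarrow{c}Z$ with $k$ a weak kernel of $c$ and $c$ a weak cokernel of $k$; these form an additive category with morphisms the commutative ladders. A weak kernel-cokernel category $(\mathcal{A};\mathcal{WKC})$ is an additive category $\mathcal{A}$ with a collection $\mathcal{WKC}$ of weak kernel-cokernel pairs (called weak conflations) which is an additive subcategory (in particular closed under finite coproducts) closed under isomorphism, and which contains $A\xrightarrow{1_A}A\to 0$ and $0\to A\xrightarrow{1_A}A$ for every object $A$. An $\mathcal{I}$-precover of $X$ is a morphism $i\colon T\to X$ in $\mathcal{I}$ through which every morphism $i'\colon T'\to X$ in $\mathcal{I}$ factors ($i'=if$ for some $f$). A $\mathcal{J}$-preenvelope of $X$ is, dually, a morphism $j\colon X\to F$ in $\mathcal{J}$ through which every morphism $X\to F'$ in $\mathcal{J}$ factors. *)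

theory Defs
  imports "HOL-Algebra.Group"
begin

section \<open>Additive categories\<close>

text \<open>Composition and addition are total functions, constrained only on composable and on
  parallel morphisms respectively.  Since every morphism determines its domain and codomain,
  collections of morphisms are plain sets.\<close>

record ('o, 'm) cat =
  Ob :: "'o set"
  Mor :: "'m set"
  Dom :: "'m \<Rightarrow> 'o"
  Cod :: "'m \<Rightarrow> 'o"
  Id :: "'o \<Rightarrow> 'm"
  Comp :: "'m \<Rightarrow> 'm \<Rightarrow> 'm"  (infixr "\<cdot>\<index>" 70)
  Add :: "'m \<Rightarrow> 'm \<Rightarrow> 'm"
  Zero :: "'o \<Rightarrow> 'o \<Rightarrow> 'm"

definition Hom :: "('o, 'm) cat \<Rightarrow> 'o \<Rightarrow> 'o \<Rightarrow> 'm set" where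
  "Hom C A B = {f \<in> Mor C. Dom C f = A \<and> Cod C f = B}"

text \<open>The additive group of morphisms, written as a multiplicative structure to match
  \<^locale>\<open>comm_group\<close>.\<close>

definition Hom_group :: "('o, 'm) cat \<Rightarrow> 'o \<Rightarrow> 'o \<Rightarrow> 'm monoid" where
  "Hom_group C A B = \<lparr>carrier = Hom C A B, mult = Add C, one = Zero C A B\<rparr>"

locale category =
  fixes C :: "('o, 'm) cat" (structure)
  assumes Dom_Ob: "f \<in> Mor C \<Longrightarrow> Dom C f \<in> Ob C"
    and Cod_Ob: "f \<in> Mor C \<Longrightarrow> Cod C f \<in> Ob C"
    and Id_Hom: "A \<in> Ob C \<Longrightarrow> Id C A \<in> Hom C A A"
    and Comp_Hom: "f \<in> Hom C A B \<Longrightarrow> g \<in> Hom C B D \<Longrightarrow> g \<cdot> f \<in> Hom C A D"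
    and Comp_Id: "f \<in> Hom C A B \<Longrightarrow> f \<cdot> Id C A = f"
    and Id_Comp: "f \<in> Hom C A B \<Longrightarrow> Id C B \<cdot> f = f"
    and Comp_assoc: "f \<in> Hom C A B \<Longrightarrow> g \<in> Hom C B D \<Longrightarrow> h \<in> Hom C D E \<Longrightarrow>
      (h \<cdot> g) \<cdot> f = h \<cdot> (g \<cdot> f)"

locale preadditive_category = category +
  assumes Hom_comm_group: "A \<in> Ob C \<Longrightarrow> B \<in> Ob C \<Longrightarrow> comm_group (Hom_group C A B)"
    and Comp_Add: "f \<in> Hom C A B \<Longrightarrow> f' \<in> Hom C A B \<Longrightarrow> g \<in> Hom C B D \<Longrightarrow>
      g \<cdot> Add C f f' = Add C (g \<cdot> f) (g \<cdot> f')"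
    and Add_Comp: "f \<in> Hom C A B \<Longrightarrow> g \<in> Hom C B D \<Longrightarrow> g' \<in> Hom C B D \<Longrightarrow>
      Add C g g' \<cdot> f = Add C (g \<cdot> f) (g' \<cdot> f)"

text \<open>\<open>S\<close> with injections \<open>u 0, \<dots>, u (n - 1)\<close> is a coproduct of \<open>A 0, \<dots>, A (n - 1)\<close>; for
  \<open>n = 0\<close> this says that \<open>S\<close> is initial.\<close>

definition is_coproduct ::
  "('o, 'm) cat \<Rightarrow> nat \<Rightarrow> (nat \<Rightarrow> 'o) \<Rightarrow> 'o \<Rightarrow> (nat \<Rightarrow> 'm) \<Rightarrow> bool" where
  "is_coproduct C n A S u \<longleftrightarrow>
     S \<in> Ob C \<and> (\<forall>k<n. u k \<in> Hom C (A k) S) \<and>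
     (\<forall>Y\<in>Ob C. \<forall>f. (\<forall>k<n. f k \<in> Hom C (A k) Y) \<longrightarrow>
        (\<exists>!h. h \<in> Hom C S Y \<and> (\<forall>k<n. h \<cdot>\<^bsub>C\<^esub> u k = f k)))"

locale additive_category = preadditive_category +
  assumes finite_coproducts: "(\<And>k. k < n \<Longrightarrow> A k \<in> Ob C) \<Longrightarrow> \<exists>S u. is_coproduct C n A S u"

definition zero_object :: "('o, 'm) cat \<Rightarrow> 'o \<Rightarrow> bool" where
  "zero_object C Z \<longleftrightarrow>
     Z \<in> Ob C \<and> (\<forall>A\<in>Ob C. (\<exists>!f. f \<in> Hom C Z A) \<and> (\<exists>!f. f \<in> Hom C A Z))"

definition isomorphic :: "('o, 'm) cat \<Rightarrow> 'o \<Rightarrow> 'o \<Rightarrow> bool" where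
  "isomorphic C A B \<longleftrightarrow>
     (\<exists>f\<in>Hom C A B. \<exists>g\<in>Hom C B A. g \<cdot>\<^bsub>C\<^esub> f = Id C A \<and> f \<cdot>\<^bsub>C\<^esub> g = Id C B)"

text \<open>Subcategories are full and given by their sets of objects, so only closure under finite
  coproducts (including the empty one) needs to be required.\<close>

definition additive_subcategory :: "('o, 'm) cat \<Rightarrow> 'o set \<Rightarrow> bool" where
  "additive_subcategory C S \<longleftrightarrow>
     S \<subseteq> Ob C \<and>
     (\<forall>n A B u. (\<forall>k<n. A k \<in> S) \<longrightarrow> is_coproduct C n A B u \<longrightarrow> B \<in> S)"

definition iso_closed :: "('o, 'm) cat \<Rightarrow> 'o set \<Rightarrow> bool" where
  "iso_closed C S \<longleftrightarrow> (\<forall>A\<in>S. \<forall>B\<in>Ob C. isomorphic C A B \<longrightarrow> B \<in> S)"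


section \<open>Ideals and ideal torsion pairs\<close>

text \<open>The subgroup of morphisms \<open>A \<rightarrow> B\<close> in the ideal is \<open>I \<inter> Hom C A B\<close>.\<close>

definition cat_ideal :: "('o, 'm) cat \<Rightarrow> 'm set \<Rightarrow> bool" where
  "cat_ideal C I \<longleftrightarrow>
     I \<subseteq> Mor C \<and>
     (\<forall>A\<in>Ob C. \<forall>B\<in>Ob C. subgroup (I \<inter> Hom C A B) (Hom_group C A B)) \<and>
     (\<forall>i\<in>I. \<forall>f\<in>Mor C. Cod C f = Dom C i \<longrightarrow> i \<cdot>\<^bsub>C\<^esub> f \<in> I) \<and>
     (\<forall>i\<in>I. \<forall>g\<in>Mor C. Dom C g = Cod C i \<longrightarrow> g \<cdot>\<^bsub>C\<^esub> i \<in> I)"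

definition hom_orthogonal :: "('o, 'm) cat \<Rightarrow> 'm \<Rightarrow> 'm \<Rightarrow> bool" where
  "hom_orthogonal C i j \<longleftrightarrow>
     (\<forall>x\<in>Hom C (Cod C i) (Dom C j). j \<cdot>\<^bsub>C\<^esub> x \<cdot>\<^bsub>C\<^esub> i = Zero C (Dom C i) (Cod C j))"

definition right_perp :: "('o, 'm) cat \<Rightarrow> 'm set \<Rightarrow> 'm set" where
  "right_perp C M = {j \<in> Mor C. \<forall>f\<in>M. hom_orthogonal C f j}"

definition left_perp :: "('o, 'm) cat \<Rightarrow> 'm set \<Rightarrow> 'm set" where
  "left_perp C M = {i \<in> Mor C. \<forall>f\<in>M. hom_orthogonal C i f}"

definition ideal_torsion_pair :: "('o, 'm) cat \<Rightarrow> 'm set \<Rightarrow> 'm set \<Rightarrow> bool" where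
  "ideal_torsion_pair C I J \<longleftrightarrow>
     cat_ideal C I \<and> cat_ideal C J \<and> I = left_perp C J \<and> J = right_perp C I"

definition precover :: "('o, 'm) cat \<Rightarrow> 'm set \<Rightarrow> 'o \<Rightarrow> 'm \<Rightarrow> bool" where
  "precover C I X i \<longleftrightarrow>
     i \<in> Mor C \<and> Cod C i = X \<and> i \<in> I \<and>
     (\<forall>i'\<in>I. Cod C i' = X \<longrightarrow> (\<exists>f\<in>Hom C (Dom C i') (Dom C i). i' = i \<cdot>\<^bsub>C\<^esub> f))"

definition preenvelope :: "('o, 'm) cat \<Rightarrow> 'm set \<Rightarrow> 'o \<Rightarrow> 'm \<Rightarrow> bool" where
  "preenvelope C J X j \<longleftrightarrow>
     j \<in> Mor C \<and> Dom C j = X \<and> j \<in> J \<and>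
     (\<forall>j'\<in>J. Dom C j' = X \<longrightarrow> (\<exists>f\<in>Hom C (Cod C j) (Cod C j'). j' = f \<cdot>\<^bsub>C\<^esub> j))"


section \<open>Weak kernel-cokernel categories\<close>

definition weak_kernel :: "('o, 'm) cat \<Rightarrow> 'm \<Rightarrow> 'm \<Rightarrow> bool" where
  "weak_kernel C k g \<longleftrightarrow>
     k \<in> Mor C \<and> g \<in> Mor C \<and> Cod C k = Dom C g \<and>
     g \<cdot>\<^bsub>C\<^esub> k = Zero C (Dom C k) (Cod C g) \<and>
     (\<forall>k'\<in>Mor C. Cod C k' = Dom C g \<longrightarrow> g \<cdot>\<^bsub>C\<^esub> k' = Zero C (Dom C k') (Cod C g) \<longrightarrow>
        (\<exists>h\<in>Hom C (Dom C k') (Dom C k). k' = k \<cdot>\<^bsub>C\<^esub> h))"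

definition weak_cokernel :: "('o, 'm) cat \<Rightarrow> 'm \<Rightarrow> 'm \<Rightarrow> bool" where
  "weak_cokernel C c g \<longleftrightarrow>
     c \<in> Mor C \<and> g \<in> Mor C \<and> Dom C c = Cod C g \<and>
     c \<cdot>\<^bsub>C\<^esub> g = Zero C (Dom C g) (Cod C c) \<and>
     (\<forall>c'\<in>Mor C. Dom C c' = Cod C g \<longrightarrow> c' \<cdot>\<^bsub>C\<^esub> g = Zero C (Dom C g) (Cod C c') \<longrightarrow>
        (\<exists>h\<in>Hom C (Cod C c) (Cod C c'). c' = h \<cdot>\<^bsub>C\<^esub> c))"

definition weak_ker_coker_pair :: "('o, 'm) cat \<Rightarrow> 'm \<times> 'm \<Rightarrow> bool" where
  "weak_ker_coker_pair C = (\<lambda>(k, c). weak_kernel C k c \<and> weak_cokernel C c k)"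

text \<open>A ladder between composable pairs; its source and target pairs are part of the data.\<close>

record 'm ladder =
  src :: "'m \<times> 'm"
  tgt :: "'m \<times> 'm"
  left_map :: 'm
  mid_map :: 'm
  right_map :: 'm

definition commutative_ladder :: "('o, 'm) cat \<Rightarrow> 'm ladder \<Rightarrow> bool" where
  "commutative_ladder C l \<longleftrightarrow>
     (case (src l, tgt l) of ((k, c), (k', c')) \<Rightarrow>
        left_map l \<in> Hom C (Dom C k) (Dom C k') \<and>
        mid_map l \<in> Hom C (Cod C k) (Cod C k') \<and>
        right_map l \<in> Hom C (Cod C c) (Cod C c') \<and>
        mid_map l \<cdot>\<^bsub>C\<^esub> k = k' \<cdot>\<^bsub>C\<^esub> left_map l \<and>
        right_map l \<cdot>\<^bsub>C\<^esub> c = c' \<cdot>\<^bsub>C\<^esub> mid_map l)"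

definition weak_ker_coker_pairs :: "('o, 'm) cat \<Rightarrow> ('m \<times> 'm, 'm ladder) cat" where
  "weak_ker_coker_pairs C =
    \<lparr>Ob = {p. weak_ker_coker_pair C p},
     Mor = {l. weak_ker_coker_pair C (src l) \<and> weak_ker_coker_pair C (tgt l) \<and>
               commutative_ladder C l},
     Dom = src,
     Cod = tgt,
     Id = (\<lambda>(k, c). \<lparr>src = (k, c), tgt = (k, c), left_map = Id C (Dom C k),
             mid_map = Id C (Cod C k), right_map = Id C (Cod C c)\<rparr>),
     Comp = (\<lambda>m l. \<lparr>src = src l, tgt = tgt m, left_map = left_map m \<cdot>\<^bsub>C\<^esub> left_map l,
             mid_map = mid_map m \<cdot>\<^bsub>C\<^esub> mid_map l, right_map = right_map m \<cdot>\<^bsub>C\<^esub> right_map l\<rparr>),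
     Add = (\<lambda>l m. \<lparr>src = src l, tgt = tgt l, left_map = Add C (left_map l) (left_map m),
             mid_map = Add C (mid_map l) (mid_map m),
             right_map = Add C (right_map l) (right_map m)\<rparr>),
     Zero = (\<lambda>(k, c) (k', c'). \<lparr>src = (k, c), tgt = (k', c'),
             left_map = Zero C (Dom C k) (Dom C k'), mid_map = Zero C (Cod C k) (Cod C k'),
             right_map = Zero C (Cod C c) (Cod C c')\<rparr>)\<rparr>"

locale weak_ker_coker_category = additive_category C for C :: "('o, 'm) cat" (structure) +
  fixes WKC :: "('m \<times> 'm) set"
  assumes WKC_additive_subcategory: "additive_subcategory (weak_ker_coker_pairs C) WKC"
    and WKC_iso_closed: "iso_closed (weak_ker_coker_pairs C) WKC"
    and Id_Zero_WKC: "A \<in> Ob C \<Longrightarrow> zero_object C Z \<Longrightarrow> (Id C A, Zero C A Z) \<in> WKC"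
    and Zero_Id_WKC: "A \<in> Ob C \<Longrightarrow> zero_object C Z \<Longrightarrow> (Zero C Z A, Id C A) \<in> WKC"

end

theory Submission
  imports Defs
begin

text \<open>A morphism \<open>i' \<in> I\<close> into \<open>X\<close> is killed by \<open>j \<in> J\<close>, hence factors through the weak kernel
  \<open>i\<close> of \<open>j\<close>.  Conversely, if \<open>i\<close> is an \<open>I\<close>-precover, then \<open>j \<cdot> x \<cdot> f\<close> with \<open>f \<in> I\<close> factors
  through \<open>j \<cdot> i = 0\<close>, because \<open>x \<cdot> f \<in> I\<close> factors through \<open>i\<close>; so \<open>j\<close> is right orthogonal
  to \<open>I\<close>.  The statement for preenvelopes is dual.\<close>

lemma (in category) Mor_Hom: "f \<in> Mor C \<Longrightarrow> f \<in> Hom C (Dom C f) (Cod C f)"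
  by (simp add: Hom_def)

lemma HomD:
  assumes "f \<in> Hom C A B"
  shows "f \<in> Mor C" "Dom C f = A" "Cod C f = B"
  using assms by (auto simp: Hom_def)

lemma (in category) Hom_Ob:
  assumes "f \<in> Hom C A B"
  shows "A \<in> Ob C" "B \<in> Ob C"
  using HomD[OF assms] Dom_Ob Cod_Ob by auto

lemma cat_ideal_Mor: "cat_ideal C I \<Longrightarrow> f \<in> I \<Longrightarrow> f \<in> Mor C"
  by (auto simp: cat_ideal_def)

text \<open>Membership equivalences, unlike the set equations that define the pair, move a single
  morphism and leave other occurrences of \<open>I\<close> and \<open>J\<close> alone.\<close>

lemma ideal_torsion_pairD:
  assumes "ideal_torsion_pair C I J"
  shows "cat_ideal C I" "cat_ideal C J" "i \<in> I \<longleftrightarrow> i \<in> left_perp C J"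
    "j \<in> J \<longleftrightarrow> j \<in> right_perp C I"
  using assms unfolding ideal_torsion_pair_def by metis+

context preadditive_category
begin

lemma Zero_Hom: "A \<in> Ob C \<Longrightarrow> B \<in> Ob C \<Longrightarrow> Zero C A B \<in> Hom C A B"
  using monoid.one_closed[OF comm_monoid.axioms(1)[OF comm_group.axioms(1)[OF Hom_comm_group]]]
  by (simp add: Hom_group_def)

lemma Add_Zero_Zero:
  assumes "A \<in> Ob C" "B \<in> Ob C"
  shows "Add C (Zero C A B) (Zero C A B) = Zero C A B"
proof -
  interpret comm_group "Hom_group C A B" using assms by (rule Hom_comm_group)
  show ?thesis using l_one[OF one_closed] by (simp add: Hom_group_def)
qed

text \<open>Cancellation of \<open>f\<close> in the group of parallel morphisms. This derives
  preservation of zero morphisms from bilinearity of composition.\<close>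

lemma Add_idem_eq_Zero:
  assumes "f \<in> Hom C A B" and "Add C f f = f"
  shows "f = Zero C A B"
proof -
  interpret comm_group "Hom_group C A B" using Hom_Ob[OF assms(1)] by (rule Hom_comm_group)
  show ?thesis using assms l_cancel_one[of f f] by (simp add: Hom_group_def)
qed

lemma Comp_Zero:
  assumes "A \<in> Ob C" and "g \<in> Hom C B D"
  shows "g \<cdot> Zero C A B = Zero C A D"
proof (rule Add_idem_eq_Zero)
  have Z: "Zero C A B \<in> Hom C A B" using assms by (simp add: Zero_Hom Hom_Ob)
  show "g \<cdot> Zero C A B \<in> Hom C A D" using Z assms(2) by (rule Comp_Hom)
  show "Add C (g \<cdot> Zero C A B) (g \<cdot> Zero C A B) = g \<cdot> Zero C A B"
    using Comp_Add[OF Z Z assms(2)] Add_Zero_Zero Hom_Ob[OF Z] by simp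
qed

lemma Zero_Comp:
  assumes "f \<in> Hom C A B" and "D \<in> Ob C"
  shows "Zero C B D \<cdot> f = Zero C A D"
proof (rule Add_idem_eq_Zero)
  have Z: "Zero C B D \<in> Hom C B D" using assms by (simp add: Zero_Hom Hom_Ob)
  show "Zero C B D \<cdot> f \<in> Hom C A D" using assms(1) Z by (rule Comp_Hom)
  show "Add C (Zero C B D \<cdot> f) (Zero C B D \<cdot> f) = Zero C B D \<cdot> f"
    using Add_Comp[OF assms(1) Z Z] Add_Zero_Zero Hom_Ob[OF Z] by simp
qed

text \<open>Orthogonality is applied to the identity of \<open>B\<close>.\<close>

lemma hom_orthogonal_Comp_eq_Zero:
  assumes "hom_orthogonal C i j" and "i \<in> Hom C A B" and "j \<in> Hom C B D"
  shows "j \<cdot> i = Zero C A D"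
proof -
  have "Id C B \<in> Hom C (Cod C i) (Dom C j)"
    using HomD[OF assms(2)] HomD[OF assms(3)] Id_Hom Hom_Ob[OF assms(3)] by simp
  then show ?thesis
    using assms(1) Id_Comp[OF assms(2)] HomD[OF assms(2)] HomD[OF assms(3)]
    by (force simp: hom_orthogonal_def)
qed

text \<open>The equation \<open>j \<cdot> i = 0\<close> gives the forward direction; the
  factorization property of the weak kernel gives the backward one.\<close>

lemma precover_iff_weak_kernel:
  assumes IJ: "ideal_torsion_pair C I J" and ker: "weak_kernel C i j"
    and i: "i \<in> Hom C T X" and j: "j \<in> Hom C X F"
  shows "precover C I X i \<longleftrightarrow> i \<in> I \<and> j \<in> J"
proof
  assume pre: "precover C I X i"
  note idl = ideal_torsion_pairD(1)[OF IJ]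
  have "hom_orthogonal C f j" if "f \<in> I" for f
    unfolding hom_orthogonal_def
  proof
    fix x assume "x \<in> Hom C (Cod C f) (Dom C j)"
    then have x: "x \<in> Hom C (Cod C f) X" using HomD[OF j] by simp
    have f: "f \<in> Hom C (Dom C f) (Cod C f)"
      using cat_ideal_Mor[OF idl that] by (rule Mor_Hom)
    \<comment> \<open>An ideal absorbs composition with \<open>x\<close>, so the precover property
      applies to \<open>x \<cdot> f\<close>.\<close>
    have "x \<cdot> f \<in> I"
      using idl that HomD[OF x] unfolding cat_ideal_def by blast
    moreover note xf = Comp_Hom[OF f x]
    ultimately obtain h where h: "h \<in> Hom C (Dom C f) T" and eq: "x \<cdot> f = i \<cdot> h"
      using pre HomD[OF i] HomD[OF xf] unfolding precover_def by metis
    have "j \<cdot> x \<cdot> f = (j \<cdot> i) \<cdot> h" using eq Comp_assoc[OF h i j] by simp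
    also have "j \<cdot> i = Zero C T F" using ker HomD[OF i] HomD[OF j] by (simp add: weak_kernel_def)
    finally show "j \<cdot> x \<cdot> f = Zero C (Dom C f) (Cod C j)"
      using Zero_Comp[OF h] Hom_Ob[OF j] HomD[OF j] by simp
  qed
  then have "j \<in> J"
    unfolding ideal_torsion_pairD(4)[OF IJ] using HomD[OF j] by (simp add: right_perp_def)
  then show "i \<in> I \<and> j \<in> J" using pre by (simp add: precover_def)
next
  assume ij: "i \<in> I \<and> j \<in> J"
  have "\<exists>f\<in>Hom C (Dom C i') (Dom C i). i' = i \<cdot> f" if i': "i' \<in> I" "Cod C i' = X" for i'
  proof -
    have orth: "hom_orthogonal C i' j" and "i' \<in> Mor C"
      using i'(1)[unfolded ideal_torsion_pairD(3)[OF IJ]] ij by (simp_all add: left_perp_def)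
    then have "i' \<in> Hom C (Dom C i') X" using i'(2) Mor_Hom by blast
    \<comment> \<open>Now \<open>j \<cdot> i' = 0\<close>, so \<open>i'\<close> factors through the
      weak kernel \<open>i\<close>.\<close>
    from hom_orthogonal_Comp_eq_Zero[OF orth this j] show ?thesis
      using ker HomD[OF j] i'(2) \<open>i' \<in> Mor C\<close> by (simp add: weak_kernel_def)
  qed
  then show "precover C I X i" using ij HomD[OF i] by (simp add: precover_def)
qed

text \<open>Dual to \<open>precover_iff_weak_kernel\<close>: all arrows are reversed, and
  \<open>I\<close> and \<open>J\<close> change roles.\<close>

lemma preenvelope_iff_weak_cokernel:
  assumes IJ: "ideal_torsion_pair C I J" and coker: "weak_cokernel C j i"
    and i: "i \<in> Hom C T X" and j: "j \<in> Hom C X F"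
  shows "preenvelope C J X j \<longleftrightarrow> i \<in> I \<and> j \<in> J"
proof
  assume pre: "preenvelope C J X j"
  note idl = ideal_torsion_pairD(2)[OF IJ]
  have "hom_orthogonal C i f" if "f \<in> J" for f
    unfolding hom_orthogonal_def
  proof
    fix x assume "x \<in> Hom C (Cod C i) (Dom C f)"
    then have x: "x \<in> Hom C X (Dom C f)" using HomD[OF i] by simp
    have f: "f \<in> Hom C (Dom C f) (Cod C f)"
      using cat_ideal_Mor[OF idl that] by (rule Mor_Hom)
    have "f \<cdot> x \<in> J"
      using idl that HomD[OF x] unfolding cat_ideal_def by blast
    moreover note fx = Comp_Hom[OF x f]
    ultimately obtain h where h: "h \<in> Hom C F (Cod C f)" and eq: "f \<cdot> x = h \<cdot> j"
      using pre HomD[OF j] HomD[OF fx] unfolding preenvelope_def by metis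
    \<comment> \<open>Composition brackets to the right, so \<open>f \<cdot> x\<close> must first be
      regrouped before \<open>eq\<close> can replace it by \<open>h \<cdot> j\<close>.\<close>
    have "f \<cdot> x \<cdot> i = h \<cdot> j \<cdot> i"
      using eq Comp_assoc[OF i x f] Comp_assoc[OF i j h] by simp
    also have "j \<cdot> i = Zero C T F"
      using coker HomD[OF i] HomD[OF j] by (simp add: weak_cokernel_def)
    finally show "f \<cdot> x \<cdot> i = Zero C (Dom C i) (Cod C f)"
      using Comp_Zero[OF _ h] Hom_Ob[OF i] HomD[OF i] by simp
  qed
  then have "i \<in> I"
    unfolding ideal_torsion_pairD(3)[OF IJ] using HomD[OF i] by (simp add: left_perp_def)
  then show "i \<in> I \<and> j \<in> J" using pre by (simp add: preenvelope_def)
next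
  assume ij: "i \<in> I \<and> j \<in> J"
  have "\<exists>f\<in>Hom C (Cod C j) (Cod C j'). j' = f \<cdot> j" if j': "j' \<in> J" "Dom C j' = X" for j'
  proof -
    have orth: "hom_orthogonal C i j'" and "j' \<in> Mor C"
      using j'(1)[unfolded ideal_torsion_pairD(4)[OF IJ]] ij by (simp_all add: right_perp_def)
    then have "j' \<in> Hom C X (Cod C j')" using j'(2) Mor_Hom by blast
    from hom_orthogonal_Comp_eq_Zero[OF orth i this] show ?thesis
      using coker HomD[OF i] j'(2) \<open>j' \<in> Mor C\<close> by (simp add: weak_cokernel_def)
  qed
  then show "preenvelope C J X j" using ij HomD[OF j] by (simp add: preenvelope_def)
qed

end

text \<open>A subcategory is encoded as a subset of \<open>Ob\<close>, and the objects of
  \<open>weak_ker_coker_pairs C\<close> are the weak kernel-cokernel pairs.\<close>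

lemma (in weak_ker_coker_category) WKC_weak_ker_coker_pair:
  "p \<in> WKC \<Longrightarrow> weak_ker_coker_pair C p"
  using WKC_additive_subcategory
  by (auto simp: additive_subcategory_def weak_ker_coker_pairs_def)

theorem theorem19:
  fixes C :: "('o, 'm) cat" and WKC :: "('m \<times> 'm) set"
    and I J :: "'m set" and X T F :: 'o and i j :: 'm
  assumes "weak_ker_coker_category C WKC"
    and "ideal_torsion_pair C I J"
    and "X \<in> Ob C"
    and "i \<in> Hom C T X" and "j \<in> Hom C X F"
    and "(i, j) \<in> WKC"
  shows "(precover C I X i \<longleftrightarrow> i \<in> I \<and> j \<in> J) \<and>
         (i \<in> I \<and> j \<in> J \<longleftrightarrow> preenvelope C J X j) \<and>
         (preenvelope C J X j \<longleftrightarrow> precover C I X i \<and> preenvelope C J X j)"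
proof -
  interpret weak_ker_coker_category C WKC by fact
  have "weak_kernel C i j" "weak_cokernel C j i"
    using WKC_weak_ker_coker_pair[OF assms(6)] by (simp_all add: weak_ker_coker_pair_def)
  then show ?thesis
    \<comment> \<open>Both one-sided conditions are equivalent to
      \<open>i \<in> I \<and> j \<in> J\<close>, hence to each other and to their
      conjunction.\<close>
    using precover_iff_weak_kernel preenvelope_iff_weak_cokernel assms(2,4,5) by metis
qed

end
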